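(* Let $s\ge 1$ be an integer, let $h$ be a fixed positive integer, and let $f,g$ be arithmetical functions having absolutely convergent Cohen-Ramanujan expansions $$f(n)=\sum_{r\ge1}\widehat f(r)\,c_r^{(s)}(n),\qquad g(n)=\sum_{k\ge1}\widehat g(k)\,c_k^{(s)}(n).$$ Suppose that $$\sum_{r,k\ge1}|\widehat f(r)|\,|\widehat g(k)|\,(r^sk^s)^{1/2}\,\tau_s(r^s)\,\tau_s(k^s)<\infty .$$ Then, as $N\to\infty$, $$\sum_{n\le N} f(n)g(n+h)\sim N\sum_{r\ge1}\widehat f(r)\,\widehat g(r)\,c_r^{(s)}(h).$$
   Context: For a positive integer $s$ and integers $m,n$ not both zero, the generalized gcd $(m,n)_s$ is the largest $l^s$ ($l\in\mathbb N$) dividing both $m$ and $n$. The Cohen-Ramanujan sum is $c_r^{(s)}(n)=\sum_{1\le a\le r^s,\ (a,r^s)_s=1} e^{2\pi i n a/r^s}$. For $s,n\in\mathbb N$, $\tau_s(n)$ is the number of $s$-th powers $l^s$ ($l\in\mathbb N$) dividing $n$. An expansion $f(n)=\sum_r \widehat f(r)c_r^{(s)}(n)$ is absolutely convergent if $\sum_r|\widehat f(r)c_r^{(s)}(n)|<\infty$ for every $n$.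
   Formalization: Write C for the series on the right. The relation ~ is asserted only when C is nonzero, since it fails for C = 0 (s = 1, f = 1, g(n) = (-1)^n); in all cases the sum is shown to equal NC + o(N), and convergence of the series for C is proved. *)

theory Defs
  imports "HOL-Analysis.Analysis" "HOL-Library.Landau_Symbols"
begin

definition gen_gcd :: "nat \<Rightarrow> int \<Rightarrow> int \<Rightarrow> nat" where
  "gen_gcd s m n = Max {l ^ s | l. 0 < l \<and> int (l ^ s) dvd m \<and> int (l ^ s) dvd n}"

definition cohen_ramanujan_sum :: "nat \<Rightarrow> nat \<Rightarrow> nat \<Rightarrow> complex" where
  "cohen_ramanujan_sum s r n =
     (\<Sum>a | a \<in> {1..r ^ s} \<and> gen_gcd s (int a) (int (r ^ s)) = 1.
        exp (2 * complex_of_real pi * \<i> * of_nat n * of_nat a / of_nat (r ^ s)))"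

definition tau_s :: "nat \<Rightarrow> nat \<Rightarrow> nat" where
  "tau_s s n = card {l ^ s | l. 0 < l \<and> l ^ s dvd n}"

text \<open>Arithmetical functions have the positive integers as their domain, so the values at
  \<open>0\<close> of \<open>f\<close> and of the coefficient function \<open>fh\<close> are irrelevant.\<close>

definition abs_conv_cr_expansion ::
  "nat \<Rightarrow> (nat \<Rightarrow> complex) \<Rightarrow> (nat \<Rightarrow> complex) \<Rightarrow> bool" where
  "abs_conv_cr_expansion s f fh \<longleftrightarrow>
     (\<forall>n\<ge>1. (\<lambda>r. norm (fh r * cohen_ramanujan_sum s r n)) summable_on {1..} \<and>
            ((\<lambda>r. fh r * cohen_ramanujan_sum s r n) has_sum f n) {1..})"

end

theory Submission
  imports Defs "HOL-Computational_Algebra.Squarefree"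
begin

text \<open>
  Expanding \<open>f(n) g(n + h)\<close> gives a double series over \<open>(r, k)\<close> whose coefficients involve the means
  \<open>1/N \<Sum> c\<^sub>r(n) c\<^sub>k(n + h)\<close> over \<open>n \<le> N\<close>. As \<open>N\<close> grows such a mean converges to \<open>c\<^sub>r(h)\<close> if
  \<open>r = k\<close> and to \<open>0\<close> otherwise, because a fraction \<open>a/r\<^sup>s\<close> with \<open>(a, r\<^sup>s)\<^sub>s = 1\<close> determines \<open>r\<close>.
  Cohen's formula \<open>c\<^sub>r(n) = \<Sum> \<mu>(r/d) d\<^sup>s\<close> over \<open>d dvd r\<close>, \<open>d\<^sup>s dvd n\<close> reduces the absolute mean to
  counting the \<open>n \<le> N\<close> with \<open>d\<^sup>s dvd n\<close> and \<open>e\<^sup>s dvd n + h\<close>. There are at most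
  \<open>min (N/d\<^sup>s) ((N + h)/e\<^sup>s)\<close> of them, hence at most the geometric mean of the two numbers,
  and so the mean is bounded by a constant times \<open>(r\<^sup>s k\<^sup>s)\<^sup>1\<^sup>/\<^sup>2 \<tau>\<^sub>s(r\<^sup>s) \<tau>\<^sub>s(k\<^sup>s)\<close>, uniformly in \<open>N\<close>.
  The double series is therefore dominated by the one assumed to converge, and the limit may be
  taken termwise.
\<close>

subsection \<open>Roots of unity\<close>

definition root_of_unity :: "nat \<Rightarrow> nat \<Rightarrow> complex" where
  "root_of_unity q a = exp (2 * complex_of_real pi * \<i> * of_nat a / of_nat q)"

lemma norm_root_of_unity [simp]: "norm (root_of_unity q a) = 1"
  by (simp add: root_of_unity_def norm_exp_eq_Re)

lemma root_of_unity_power: "root_of_unity q a ^ n = root_of_unity q (n * a)"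
  by (simp add: root_of_unity_def mult_ac flip: exp_of_nat_mult)

lemma root_of_unity_eq_1_iff: "q > 0 \<Longrightarrow> root_of_unity q a = 1 \<longleftrightarrow> q dvd a"
  using complex_root_unity_eq_1[of q a] by (simp add: root_of_unity_def)

lemma root_of_unity_cancel: "m > 0 \<Longrightarrow> root_of_unity (m * q) (m * a) = root_of_unity q a"
  by (simp add: root_of_unity_def mult_ac)

lemma root_of_unity_eqD:
  assumes "root_of_unity q a = root_of_unity q' b" "a \<in> {1..q}" "b \<in> {1..q'}"
  shows "a * q' = b * q"
proof -
  have pos: "q > 0" "q' > 0"
    using assms by auto
  have "root_of_unity (q' * q) (q' * a) = root_of_unity (q' * q) (q * b)"
    using assms(1) pos root_of_unity_cancel[of q' q a] root_of_unity_cancel[of q q' b]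
    by (simp add: mult.commute)
  then have congruent: "q' * a mod (q' * q) = q * b mod (q' * q)"
    using pos complex_root_unity_eq[of "q' * q" "q' * a" "q * b"]
    by (simp only: root_of_unity_def) simp
  have "0 < q' * a" "q' * a \<le> q' * q" "0 < q * b" "q * b \<le> q' * q"
    using assms(2,3) pos by (auto simp: mult.commute)
  then have "q' * a = q * b"
    using congruent by (metis le_neq_implies_less less_irrefl mod_less mod_self)
  then show ?thesis
    by (simp add: mult.commute)
qed

lemma sum_root_of_unity_powers:
  assumes "q > 0"
  shows "(\<Sum>a=1..q. root_of_unity q a ^ n) = (if q dvd n then of_nat q else 0)"
proof -
  have "(\<Sum>a=1..q. root_of_unity q a ^ n) = (\<Sum>a=1..q. root_of_unity q n ^ a)"
    by (simp add: root_of_unity_power mult.commute)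
  moreover have "root_of_unity q n ^ q = 1"
    using assms by (simp add: root_of_unity_power root_of_unity_eq_1_iff)
  ultimately show ?thesis
    using assms by (simp add: sum_gp root_of_unity_eq_1_iff)
qed

lemma sum_root_of_unity_powers_multiples:
  assumes "q > 0" "m dvd q"
  shows "(\<Sum>a | a \<in> {1..q} \<and> m dvd a. root_of_unity q a ^ n) =
           of_nat (if q div m dvd n then q div m else 0)"
proof -
  obtain k where q_eq: "q = m * k"
    using assms(2) by blast
  with assms(1) have pos: "m > 0" "k > 0"
    by simp_all
  have "(\<Sum>a | a \<in> {1..m * k} \<and> m dvd a. root_of_unity (m * k) a ^ n) =
        (\<Sum>b=1..k. root_of_unity k b ^ n)"
    using pos
    by (intro sum.reindex_bij_witness[of _ "\<lambda>b. m * b" "\<lambda>a. a div m"])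
       (auto simp: root_of_unity_cancel Suc_le_eq elim!: dvdE)
  then show ?thesis
    using pos by (simp only: q_eq sum_root_of_unity_powers) simp
qed

lemma mult_cnj_eq_1_iff:
  assumes "norm w = 1"
  shows "z * cnj w = 1 \<longleftrightarrow> z = w"
proof -
  have "w * cnj w = 1"
    using assms by (simp flip: complex_norm_square)
  then show ?thesis
    by (metis mult_cancel_right mult_zero_right zero_neq_one)
qed

subsection \<open>The Moebius function and the generalized gcd\<close>

definition moebius_mu :: "nat \<Rightarrow> int" where
  "moebius_mu n = (if squarefree n then (-1) ^ card (prime_factors n) else 0)"

lemma abs_moebius_mu_le: "\<bar>moebius_mu n\<bar> \<le> 1"
  by (simp add: moebius_mu_def power_abs)

lemma prime_factors_Prod_primes:
  fixes T :: "nat set"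
  assumes "finite T" "\<And>p. p \<in> T \<Longrightarrow> prime p"
  shows "prime_factors (\<Prod>T) = T"
  using assms by (subst prime_factors_prod) (fastforce simp: prime_prime_factors)+

lemma Prod_prime_factors_squarefree:
  assumes "squarefree (n :: nat)"
  shows "\<Prod>(prime_factors n) = n"
proof -
  have "n \<noteq> 0"
    using assms by (intro notI) simp
  then have "n = (\<Prod>p\<in>prime_factors n. p ^ multiplicity p n)"
    by (simp add: prod_prime_factors)
  also have "\<dots> = \<Prod>(prime_factors n)"
    using assms \<open>n \<noteq> 0\<close> by (intro prod.cong) (auto simp: squarefree_factorial_semiring')
  finally show ?thesis ..
qed

lemma bij_betw_Prod_squarefree_divisors:
  fixes n :: nat
  assumes "n > 0"
  shows "bij_betw Prod (Pow (prime_factors n)) {d. d dvd n \<and> squarefree d}"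
proof (rule bij_betw_byWitness[where f' = prime_factors])
  have primes: "finite T" "\<And>p. p \<in> T \<Longrightarrow> prime p"
    if "T \<in> Pow (prime_factors n)" for T
    using that by (auto intro: finite_subset)
  show "\<forall>T\<in>Pow (prime_factors n). prime_factors (\<Prod>T) = T"
    by (intro ballI prime_factors_Prod_primes primes)
  show "\<forall>d\<in>{d. d dvd n \<and> squarefree d}. \<Prod>(prime_factors d) = d"
    using Prod_prime_factors_squarefree by blast
  show "Prod ` Pow (prime_factors n) \<subseteq> {d. d dvd n \<and> squarefree d}"
  proof (intro image_subsetI CollectI conjI)
    fix T assume T_in: "T \<in> Pow (prime_factors n)"
    have "\<Prod>T dvd \<Prod>(prime_factors n)"
      using T_in by (intro prod_dvd_prod_subset) auto
    also have "\<dots> dvd (\<Prod>p\<in>prime_factors n. p ^ multiplicity p n)"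
      by (intro prod_dvd_prod) (auto simp: prime_factors_multiplicity)
    also have "\<dots> = n"
      using assms by (simp add: prod_prime_factors)
    finally show "\<Prod>T dvd n" .
    show "squarefree (\<Prod>T)"
      by (intro squarefree_prod_coprime)
        (auto intro: primes_coprime squarefree_prime primes(2)[OF T_in])
  qed
  show "prime_factors ` {d. d dvd n \<and> squarefree d} \<subseteq> Pow (prime_factors n)"
    using assms by (auto simp: in_prime_factors_iff intro: dvd_trans)
qed

lemma sum_moebius_mu_divisors:
  assumes "n > 0"
  shows "(\<Sum>d | d dvd n. moebius_mu d) = of_bool (n = 1)"
proof -
  let ?P = "prime_factors n"
  have "(\<Sum>d | d dvd n. moebius_mu d) = (\<Sum>d | d dvd n \<and> squarefree d. moebius_mu d)"
    using assms by (intro sum.mono_neutral_right) (auto simp: moebius_mu_def)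
  also have "\<dots> = (\<Sum>d | d dvd n \<and> squarefree d. (-1) ^ card (prime_factors d))"
    by (simp add: moebius_mu_def)
  also have "\<dots> = (\<Sum>T\<in>Pow ?P. (-1) ^ card (prime_factors (\<Prod>T)))"
    by (rule sum.reindex_bij_betw[OF bij_betw_Prod_squarefree_divisors[OF assms], symmetric])
  also have "\<dots> = (\<Sum>T\<in>Pow ?P. (-1) ^ card T)"
    by (intro sum.cong refl) (subst prime_factors_Prod_primes, auto intro: finite_subset)
  also have "\<dots> = (\<Prod>p\<in>?P. 1 - 1)"
    by (subst prod_diff_conv_sum) simp_all
  also have "\<dots> = of_bool (n = 1)"
    using assms by (cases "n = 1") (auto simp: prime_factorization_empty_iff card_gt_0_iff)
  finally show ?thesis .
qed

lemma lcm_power_nat: "lcm (a ^ n) (b ^ n) = lcm a b ^ n" for a b :: nat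
proof (cases "gcd a b = 0")
  case False
  have "gcd a b ^ n * lcm (a ^ n) (b ^ n) = gcd a b ^ n * lcm a b ^ n"
    by (metis gcd_exp power_mult_distrib prod_gcd_lcm_nat)
  with False show ?thesis by auto
qed (auto simp: power_0_left)

text \<open>The \<open>s\<close>-th powers dividing \<open>c\<close> are closed under \<open>lcm\<close>, so the largest one is a multiple
  of all others.\<close>

lemma largest_power_divisor:
  fixes c s :: nat
  assumes "c > 0" "s > 0"
  obtains g where "\<And>l. l ^ s dvd c \<longleftrightarrow> l dvd g"
proof
  define L where "L = {l. l ^ s dvd c}"
  have "l \<le> c" if "l \<in> L" for l
    using that assms self_le_power[of l s] dvd_imp_le[of "l ^ s" c]
    by (cases "l = 0") (auto simp: L_def intro: order_trans)
  then have "finite L"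
    by (meson atMost_iff finite_atMost rev_finite_subset subsetI)
  have "1 \<in> L"
    by (simp add: L_def)
  then have "Max L \<in> L"
    using \<open>finite L\<close> by (intro Max_in) auto
  fix l
  show "l ^ s dvd c \<longleftrightarrow> l dvd Max L"
  proof
    assume "l ^ s dvd c"
    then have "lcm l (Max L) \<in> L"
      using \<open>Max L \<in> L\<close> by (simp add: L_def flip: lcm_power_nat)
    then have "lcm l (Max L) \<le> Max L"
      using \<open>finite L\<close> by simp
    moreover have "l > 0" "Max L > 0"
      using \<open>l ^ s dvd c\<close> \<open>Max L \<in> L\<close> assms by (auto simp: L_def intro!: Nat.gr0I)
    ultimately show "l dvd Max L"
      by (metis dvd_imp_le dvd_lcm1 dvd_lcm2 lcm_pos_nat le_antisym)
  next
    assume "l dvd Max L"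
    then show "l ^ s dvd c"
      using \<open>Max L \<in> L\<close> by (auto simp: L_def intro: dvd_trans dvd_power_same)
  qed
qed

lemma gen_gcd_eq_power:
  assumes "s > 0" "m \<noteq> 0 \<or> n \<noteq> 0"
  obtains g where "g > 0" "gen_gcd s m n = g ^ s"
    "\<And>l. int (l ^ s) dvd m \<and> int (l ^ s) dvd n \<longleftrightarrow> l dvd g"
proof -
  define c where "c = nat (gcd m n)"
  have common_dvd: "int q dvd m \<and> int q dvd n \<longleftrightarrow> q dvd c" for q
    by (simp add: c_def flip: int_dvd_int_iff)
  have "c > 0"
    using assms by (simp add: c_def)
  then obtain g where power_dvd: "\<And>l. l ^ s dvd c \<longleftrightarrow> l dvd g"
    using assms(1) largest_power_divisor by blast
  have "g > 0"
    using power_dvd[of 0] \<open>c > 0\<close> assms(1) by (auto intro: Nat.gr0I)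
  have "{l ^ s | l. 0 < l \<and> int (l ^ s) dvd m \<and> int (l ^ s) dvd n} = (\<lambda>l. l ^ s) ` {l. l dvd g}"
    using \<open>g > 0\<close> unfolding common_dvd power_dvd by (fastforce intro: Nat.gr0I)
  moreover have "Max ((\<lambda>l. l ^ s) ` {l. l dvd g}) = g ^ s"
    using \<open>g > 0\<close> by (intro Max_eqI) (auto intro: power_mono dvd_imp_le)
  ultimately have "gen_gcd s m n = g ^ s"
    by (simp only: gen_gcd_def)
  with \<open>g > 0\<close> show thesis
    by (rule that) (simp only: common_dvd power_dvd)
qed

lemma sum_moebius_mu_common_power_divisors:
  assumes "s > 0" "m \<noteq> 0 \<or> n \<noteq> 0"
  shows "(\<Sum>d | int (d ^ s) dvd m \<and> int (d ^ s) dvd n. moebius_mu d) = of_bool (gen_gcd s m n = 1)"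
proof -
  obtain g where "g > 0" and gen_gcd_eq: "gen_gcd s m n = g ^ s"
    and common_dvd: "\<And>l. int (l ^ s) dvd m \<and> int (l ^ s) dvd n \<longleftrightarrow> l dvd g"
    using gen_gcd_eq_power[OF assms] by blast
  have "g ^ s = 1 \<longleftrightarrow> g = 1"
    using assms(1) by simp
  then show ?thesis
    unfolding gen_gcd_eq common_dvd sum_moebius_mu_divisors[OF \<open>g > 0\<close>] by simp
qed

subsection \<open>Cohen's formula\<close>

definition cohen_residues :: "nat \<Rightarrow> nat \<Rightarrow> nat set" where
  "cohen_residues s r = {a \<in> {1..r ^ s}. gen_gcd s (int a) (int (r ^ s)) = 1}"

lemma cohen_ramanujan_sum_eq_powers:
  "cohen_ramanujan_sum s r n = (\<Sum>a\<in>cohen_residues s r. root_of_unity (r ^ s) a ^ n)"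
  unfolding cohen_ramanujan_sum_def cohen_residues_def root_of_unity_power
  by (intro sum.cong) (simp_all add: root_of_unity_def mult_ac)

lemma cohen_residuesD:
  assumes "s > 0" "a \<in> cohen_residues s r" "l dvd r" "l ^ s dvd a"
  shows "l = 1"
proof -
  have "int a \<noteq> 0 \<or> int (r ^ s) \<noteq> 0"
    using assms(2) by (simp add: cohen_residues_def)
  then obtain g where gen_gcd_eq: "gen_gcd s (int a) (int (r ^ s)) = g ^ s"
    and common_dvd: "\<And>l. int (l ^ s) dvd int a \<and> int (l ^ s) dvd int (r ^ s) \<longleftrightarrow> l dvd g"
    using gen_gcd_eq_power[OF assms(1)] by blast
  have "l dvd g"
    using assms(3,4) common_dvd[of l] by (simp add: dvd_power_same del: of_nat_power)
  moreover have "g = 1"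
    using gen_gcd_eq assms(1,2) by (simp add: cohen_residues_def)
  ultimately show ?thesis
    by simp
qed

lemma of_bool_mem_cohen_residues:
  assumes "s > 0" "a \<in> {1..r ^ s}"
  shows "of_bool (a \<in> cohen_residues s r) = (\<Sum>d | d dvd r \<and> d ^ s dvd a. moebius_mu d)"
proof -
  have "int (d ^ s) dvd int a \<and> int (d ^ s) dvd int (r ^ s) \<longleftrightarrow> d dvd r \<and> d ^ s dvd a" for d
    using assms(1) unfolding int_dvd_int_iff by (auto simp: pow_divides_pow_iff)
  then show ?thesis
    using assms sum_moebius_mu_common_power_divisors[of s "int a" "int (r ^ s)"]
    by (simp add: cohen_residues_def del: of_nat_power)
qed

lemma cohen_ramanujan_sum_moebius:
  assumes "s > 0" "r > 0"
  shows "cohen_ramanujan_sum s r n =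
    of_int (\<Sum>d | d dvd r \<and> d ^ s dvd n. moebius_mu (r div d) * int (d ^ s))"
proof -
  let ?z = "\<lambda>a. root_of_unity (r ^ s) a ^ n"
  have multiples: "(\<Sum>a | a \<in> {1..r ^ s} \<and> d ^ s dvd a. ?z a) =
      of_nat (if (r div d) ^ s dvd n then (r div d) ^ s else 0)" if "d dvd r" for d
    using sum_root_of_unity_powers_multiples[of "r ^ s" "d ^ s" n] that assms(2)
    by (simp only: dvd_power_same div_power zero_less_power)
  have "cohen_ramanujan_sum s r n = (\<Sum>a=1..r ^ s. of_int (of_bool (a \<in> cohen_residues s r)) * ?z a)"
    unfolding cohen_ramanujan_sum_eq_powers
    by (intro sum.mono_neutral_cong_left) (auto simp: cohen_residues_def)
  also have "\<dots> = (\<Sum>a=1..r ^ s. \<Sum>d | d \<in> {d. d dvd r} \<and> d ^ s dvd a. of_int (moebius_mu d) * ?z a)"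
    using assms(1) by (intro sum.cong refl) (simp add: of_bool_mem_cohen_residues sum_distrib_right)
  also have "\<dots> = (\<Sum>d | d dvd r. \<Sum>a | a \<in> {1..r ^ s} \<and> d ^ s dvd a. of_int (moebius_mu d) * ?z a)"
    using assms(2) by (intro sum.swap_restrict) auto
  also have "\<dots> = (\<Sum>d | d dvd r. of_int (moebius_mu d) *
      of_nat (if (r div d) ^ s dvd n then (r div d) ^ s else 0))"
    unfolding sum_distrib_left[symmetric]
    by (intro sum.cong refl) (simp only: multiples mem_Collect_eq)
  also have "\<dots> = (\<Sum>d | d dvd r. of_int (moebius_mu (r div d)) *
      of_nat (if d ^ s dvd n then d ^ s else 0))"
    using assms(2) by (intro sum.reindex_bij_witness[of _ "\<lambda>d. r div d" "\<lambda>d. r div d"]) auto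
  also have "\<dots> = (\<Sum>d | d dvd r \<and> d ^ s dvd n. of_int (moebius_mu (r div d) * int (d ^ s)))"
    using assms(2) by (intro sum.mono_neutral_cong_right) auto
  finally show ?thesis
    by simp
qed

lemma cnj_cohen_ramanujan_sum:
  assumes "s > 0" "r > 0"
  shows "cnj (cohen_ramanujan_sum s r n) = cohen_ramanujan_sum s r n"
  by (simp add: cohen_ramanujan_sum_moebius[OF assms])

definition power_divisors :: "nat \<Rightarrow> nat \<Rightarrow> nat set" where
  "power_divisors s m = {l ^ s | l. 0 < l \<and> l ^ s dvd m}"

lemma tau_s_eq_card_power_divisors: "tau_s s m = card (power_divisors s m)"
  by (simp add: tau_s_def power_divisors_def)

lemma finite_power_divisors: "m > 0 \<Longrightarrow> finite (power_divisors s m)"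
  by (rule finite_subset[of _ "{d. d dvd m}"]) (auto simp: power_divisors_def)

lemma norm_cohen_ramanujan_sum_le:
  assumes "s > 0" "r > 0"
  shows "norm (cohen_ramanujan_sum s r n) \<le> (\<Sum>d | d \<in> power_divisors s (r ^ s) \<and> d dvd n. real d)"
proof -
  have "norm (cohen_ramanujan_sum s r n) \<le> (\<Sum>d | d dvd r \<and> d ^ s dvd n. real (d ^ s))"
    unfolding cohen_ramanujan_sum_moebius[OF assms] of_int_sum
  proof (rule sum_norm_le)
    fix d
    have "real_of_int \<bar>moebius_mu (r div d)\<bar> \<le> 1"
      using abs_moebius_mu_le[of "r div d"] by linarith
    then show "norm (of_int (moebius_mu (r div d) * int (d ^ s)) :: complex) \<le> real (d ^ s)"
      using mult_right_mono[of "real_of_int \<bar>moebius_mu (r div d)\<bar>" 1 "real (d ^ s)"]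
      by (simp add: norm_mult norm_power)
  qed
  also have "\<dots> = (\<Sum>d\<in>(\<lambda>d. d ^ s) ` {d. d dvd r \<and> d ^ s dvd n}. real d)"
    using assms(1) by (subst sum.reindex) (auto intro!: inj_onI simp: power_eq_iff_eq_base)
  also have "(\<lambda>d. d ^ s) ` {d. d dvd r \<and> d ^ s dvd n} = {d. d \<in> power_divisors s (r ^ s) \<and> d dvd n}"
  proof -
    have "d dvd r \<longleftrightarrow> 0 < d \<and> d ^ s dvd r ^ s" for d
      using assms by (auto simp: pow_divides_pow_iff intro: dvd_pos_nat)
    then show ?thesis
      by (auto simp: power_divisors_def)
  qed
  finally show ?thesis .
qed

subsection \<open>Shifted means\<close>

definition shifted_mean :: "(nat \<Rightarrow> complex) \<Rightarrow> (nat \<Rightarrow> complex) \<Rightarrow> nat \<Rightarrow> nat \<Rightarrow> complex" where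
  "shifted_mean f g h = (\<lambda>N. (\<Sum>n=1..N. f n * g (n + h)) / of_nat N)"

lemma card_multiples_shift_le: "card {n \<in> {1..N}. q dvd n + h} \<le> (N + h) div q"
proof (cases "q = 0")
  case False
  have "inj_on (\<lambda>n. (n + h) div q) {n \<in> {1..N}. q dvd n + h}"
    by (rule inj_onI) (metis (no_types, lifting) add_right_cancel dvd_div_mult_self mem_Collect_eq)
  then have "card {n \<in> {1..N}. q dvd n + h} \<le> card {1..(N + h) div q}"
  proof (rule card_inj_on_le)
    show "(\<lambda>n. (n + h) div q) ` {n \<in> {1..N}. q dvd n + h} \<subseteq> {1..(N + h) div q}"
      using False by (auto simp: Suc_le_eq div_greater_zero_iff div_le_mono dvd_imp_le)
  qed simp
  then show ?thesis
    by simp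
qed simp

lemma mult_card_common_multiples_shift_le:
  "real d * real e * real (card {n \<in> {1..N}. d dvd n \<and> e dvd n + h})
    \<le> sqrt (real (N * (N + h))) * (sqrt (real d) * sqrt (real e))"
proof -
  define C where "C = card {n \<in> {1..N}. d dvd n \<and> e dvd n + h}"
  have "C \<le> card {n \<in> {1..N}. d dvd n + 0}" "C \<le> card {n \<in> {1..N}. e dvd n + h}"
    unfolding C_def by (intro card_mono; auto)+
  then have "C \<le> N div d" "C \<le> (N + h) div e"
    using card_multiples_shift_le[of N d 0] card_multiples_shift_le[of N e h] by simp_all
  then have "d * C \<le> N" "e * C \<le> N + h"
    by (meson le_trans mult_le_mono2 times_div_less_eq_dividend)+
  then have "(d * C) * (e * C) * (d * e) \<le> N * (N + h) * (d * e)"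
    by (intro mult_le_mono) auto
  then have "(d * e * C)\<^sup>2 \<le> N * (N + h) * (d * e)"
    by (simp add: power2_eq_square mult_ac)
  then have "(real (d * e * C))\<^sup>2 \<le> real (N * (N + h) * (d * e))"
    by (metis of_nat_mono of_nat_power)
  then have "real (d * e * C) \<le> sqrt (real (N * (N + h) * (d * e)))"
    by (rule real_le_rsqrt)
  then show ?thesis
    by (simp add: C_def real_sqrt_mult)
qed

lemma sum_divisor_sums_shift_le:
  fixes D E :: "nat set"
  assumes "finite D" "finite E"
  shows "(\<Sum>n=1..N. (\<Sum>d | d \<in> D \<and> d dvd n. real d) * (\<Sum>e | e \<in> E \<and> e dvd n + h. real e))
    \<le> sqrt (real (N * (N + h))) * ((\<Sum>d\<in>D. sqrt (real d)) * (\<Sum>e\<in>E. sqrt (real e)))"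
proof -
  let ?C = "\<lambda>d e. card {n \<in> {1..N}. d dvd n \<and> e dvd n + h}"
  have "(\<Sum>n=1..N. (\<Sum>d | d \<in> D \<and> d dvd n. real d) * (\<Sum>e | e \<in> E \<and> e dvd n + h. real e))
      = (\<Sum>n=1..N. \<Sum>p | p \<in> D \<times> E \<and> fst p dvd n \<and> snd p dvd n + h. real (fst p) * real (snd p))"
    unfolding sum_product sum.cartesian_product case_prod_unfold by (intro sum.cong) auto
  also have "\<dots> = (\<Sum>p\<in>D \<times> E. \<Sum>n | n \<in> {1..N} \<and> fst p dvd n \<and> snd p dvd n + h.
      real (fst p) * real (snd p))"
    using assms by (intro sum.swap_restrict) auto
  also have "\<dots> = (\<Sum>p\<in>D \<times> E. real (fst p) * real (snd p) * real (?C (fst p) (snd p)))"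
    by (simp add: mult_ac)
  also have "\<dots> \<le> (\<Sum>p\<in>D \<times> E.
      sqrt (real (N * (N + h))) * (sqrt (real (fst p)) * sqrt (real (snd p))))"
    by (intro sum_mono mult_card_common_multiples_shift_le)
  also have "\<dots> = sqrt (real (N * (N + h))) * (\<Sum>p\<in>D \<times> E. sqrt (real (fst p)) * sqrt (real (snd p)))"
    by (rule sum_distrib_left[symmetric])
  also have "(\<Sum>p\<in>D \<times> E. sqrt (real (fst p)) * sqrt (real (snd p))) =
      (\<Sum>d\<in>D. sqrt (real d)) * (\<Sum>e\<in>E. sqrt (real e))"
    by (simp only: sum_product sum.cartesian_product case_prod_unfold)
  finally show ?thesis .
qed

lemma sum_sqrt_power_divisors_le:
  assumes "m > 0"
  shows "(\<Sum>d\<in>power_divisors s m. sqrt (real d)) \<le> sqrt (real m) * real (tau_s s m)"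
proof -
  have "(\<Sum>d\<in>power_divisors s m. sqrt (real d)) \<le> real (card (power_divisors s m)) * sqrt (real m)"
    using assms
    by (intro sum_bounded_above) (auto simp: power_divisors_def dvd_imp_le simp del: of_nat_power)
  then show ?thesis
    by (simp add: tau_s_eq_card_power_divisors mult.commute)
qed

lemma norm_sum_cohen_ramanujan_sum_shift_le:
  assumes "s > 0" "r > 0" "k > 0"
  shows "norm (\<Sum>n=1..N. cohen_ramanujan_sum s r n * cohen_ramanujan_sum s k (n + h)) \<le>
    sqrt (real (N * (N + h))) *
      (sqrt (real (r ^ s)) * real (tau_s s (r ^ s)) *
        (sqrt (real (k ^ s)) * real (tau_s s (k ^ s))))"
proof -
  let ?D = "\<lambda>r n. \<Sum>d | d \<in> power_divisors s (r ^ s) \<and> d dvd n. real d"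
  have pos: "r ^ s > 0" "k ^ s > 0"
    using assms by simp_all
  have "norm (\<Sum>n=1..N. cohen_ramanujan_sum s r n * cohen_ramanujan_sum s k (n + h))
      \<le> (\<Sum>n=1..N. ?D r n * ?D k (n + h))"
    by (intro sum_norm_le)
      (auto simp: norm_mult intro!: mult_mono norm_cohen_ramanujan_sum_le assms sum_nonneg)
  also have "\<dots> \<le> sqrt (real (N * (N + h))) * ((\<Sum>d\<in>power_divisors s (r ^ s). sqrt (real d)) *
      (\<Sum>e\<in>power_divisors s (k ^ s). sqrt (real e)))"
    by (intro sum_divisor_sums_shift_le finite_power_divisors pos)
  also have "\<dots> \<le> sqrt (real (N * (N + h))) *
      (sqrt (real (r ^ s)) * real (tau_s s (r ^ s)) *
        (sqrt (real (k ^ s)) * real (tau_s s (k ^ s))))"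
    by (intro mult_left_mono mult_mono sum_sqrt_power_divisors_le pos sum_nonneg) auto
  finally show ?thesis .
qed

lemma norm_shifted_mean_cohen_ramanujan_sum_le:
  assumes "s > 0" "r > 0" "k > 0"
  shows "norm (shifted_mean (cohen_ramanujan_sum s r) (cohen_ramanujan_sum s k) h N) \<le>
    sqrt (real (1 + h)) *
      (sqrt (real (r ^ s) * real (k ^ s)) * real (tau_s s (r ^ s)) * real (tau_s s (k ^ s)))"
    (is "_ \<le> _ * ?B")
proof (cases "N = 0")
  case False
  have "N * (N + h) \<le> N\<^sup>2 * (1 + h)"
    using False by (cases N) (simp_all add: power2_eq_square algebra_simps)
  then have "sqrt (real (N * (N + h))) \<le> sqrt ((real N)\<^sup>2 * real (1 + h))"
    by (metis of_nat_mono of_nat_mult of_nat_power real_sqrt_le_mono)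
  then have "sqrt (real (N * (N + h))) \<le> real N * sqrt (real (1 + h))"
    by (simp only: real_sqrt_mult real_sqrt_abs abs_of_nat)
  then have "sqrt (real (N * (N + h))) * ?B \<le> real N * sqrt (real (1 + h)) * ?B"
    by (intro mult_right_mono) auto
  moreover have "norm (\<Sum>n=1..N. cohen_ramanujan_sum s r n * cohen_ramanujan_sum s k (n + h))
      \<le> sqrt (real (N * (N + h))) * ?B"
    using norm_sum_cohen_ramanujan_sum_shift_le[OF assms, where N = N and h = h]
    by (simp only: real_sqrt_mult mult_ac)
  ultimately show ?thesis
    using False by (simp add: shifted_mean_def norm_divide divide_le_eq mult_ac)
qed (simp add: shifted_mean_def)

lemma mean_power_tendsto:
  fixes z :: "'a :: real_normed_field"
  assumes "norm z \<le> 1"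
  shows "(\<lambda>N. (\<Sum>n=1..N. z ^ n) / of_nat N) \<longlonglongrightarrow> of_bool (z = 1)"
proof (cases "z = 1")
  case True
  show ?thesis
    using eventually_gt_at_top[of 0] by (intro tendsto_eventually, eventually_elim) (simp add: True)
next
  case False
  have "norm (\<Sum>n=1..N. z ^ n) \<le> 2 / norm (1 - z)" for N
  proof -
    have "norm (z ^ 1 - z ^ Suc N) \<le> norm (z ^ 1) + norm (z ^ Suc N)"
      by (rule norm_triangle_ineq4)
    also have "\<dots> \<le> 1 + 1"
      using assms unfolding norm_power by (intro add_mono power_le_one) auto
    finally show ?thesis
      using False by (simp add: sum_gp norm_divide divide_right_mono)
  qed
  then have "norm ((\<Sum>n=1..N. z ^ n) / of_nat N) \<le> 2 / norm (1 - z) / real N" for N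
    unfolding norm_divide norm_of_nat by (rule divide_right_mono) simp
  then have "(\<lambda>N. (\<Sum>n=1..N. z ^ n) / of_nat N) \<longlonglongrightarrow> 0"
    by (intro Lim_null_comparison[OF _ lim_const_over_n] always_eventually allI)
  then show ?thesis
    using False by simp
qed

lemma shifted_mean_power_sums_tendsto:
  assumes "\<And>a. a \<in> A \<Longrightarrow> norm (w a) \<le> 1" "\<And>b. b \<in> B \<Longrightarrow> norm (v b) \<le> 1"
  shows "shifted_mean (\<lambda>n. \<Sum>a\<in>A. w a ^ n) (\<lambda>n. \<Sum>b\<in>B. v b ^ n) h
    \<longlonglongrightarrow> (\<Sum>a\<in>A. \<Sum>b\<in>B. v b ^ h * of_bool (w a * v b = 1))"
proof -
  have "(\<Sum>n=1..N. (\<Sum>a\<in>A. w a ^ n) * (\<Sum>b\<in>B. v b ^ (n + h))) =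
      (\<Sum>a\<in>A. \<Sum>b\<in>B. v b ^ h * (\<Sum>n=1..N. (w a * v b) ^ n))" for N
  proof -
    have "(\<Sum>n=1..N. (\<Sum>a\<in>A. w a ^ n) * (\<Sum>b\<in>B. v b ^ (n + h))) =
        (\<Sum>n=1..N. \<Sum>a\<in>A. \<Sum>b\<in>B. v b ^ h * (w a * v b) ^ n)"
      unfolding sum_product by (simp add: power_add power_mult_distrib mult_ac)
    also have "\<dots> = (\<Sum>a\<in>A. \<Sum>n=1..N. \<Sum>b\<in>B. v b ^ h * (w a * v b) ^ n)"
      by (rule sum.swap)
    also have "\<dots> = (\<Sum>a\<in>A. \<Sum>b\<in>B. \<Sum>n=1..N. v b ^ h * (w a * v b) ^ n)"
      by (intro sum.cong refl sum.swap)
    finally show ?thesis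
      by (simp add: sum_distrib_left)
  qed
  then have "shifted_mean (\<lambda>n. \<Sum>a\<in>A. w a ^ n) (\<lambda>n. \<Sum>b\<in>B. v b ^ n) h =
      (\<lambda>N. \<Sum>a\<in>A. \<Sum>b\<in>B. v b ^ h * ((\<Sum>n=1..N. (w a * v b) ^ n) / of_nat N))"
    by (simp only: shifted_mean_def sum_divide_distrib[where A = A] sum_divide_distrib[where A = B]
        times_divide_eq_right)
  moreover have "norm (w a * v b) \<le> 1" if "a \<in> A" "b \<in> B" for a b
    using assms that by (simp add: norm_mult mult_le_one)
  ultimately show ?thesis
    by (simp only:) (intro tendsto_sum tendsto_mult_left mean_power_tendsto)
qed

lemma cohen_residues_cross_eq_imp_dvd:
  assumes "s > 0" "r > 0" "a \<in> cohen_residues s r" "a * k ^ s = b * r ^ s"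
  shows "r dvd k"
proof -
  obtain r' k' where r_eq: "r = r' * gcd r k" and k_eq: "k = k' * gcd r k" and "coprime r' k'"
    using gcd_coprime_exists[of r k] assms(2) by auto
  have "gcd r k > 0"
    using assms(2) by simp
  have "gcd r k ^ s * (a * k' ^ s) = gcd r k ^ s * (b * r' ^ s)"
    using assms(4)
    by (subst (asm) (1) r_eq, subst (asm) (1) k_eq) (simp add: power_mult_distrib mult_ac)
  then have "a * k' ^ s = b * r' ^ s"
    using \<open>gcd r k > 0\<close> by auto
  then have "r' ^ s dvd a * k' ^ s"
    by simp
  then have "r' ^ s dvd a"
    using \<open>coprime r' k'\<close> by (simp add: coprime_dvd_mult_left_iff)
  then have "r' = 1"
    using assms(1,3) r_eq by (metis cohen_residuesD dvd_triv_left)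
  then show ?thesis
    using r_eq by (metis gcd_dvd2 mult_1)
qed

lemma root_of_unity_cohen_residues_eq_iff:
  assumes "s > 0" "r > 0" "k > 0" "a \<in> cohen_residues s r" "b \<in> cohen_residues s k"
  shows "root_of_unity (r ^ s) a = root_of_unity (k ^ s) b \<longleftrightarrow> r = k \<and> a = b"
proof
  assume "root_of_unity (r ^ s) a = root_of_unity (k ^ s) b"
  then have cross_eq: "a * k ^ s = b * r ^ s"
    using assms(4,5) by (intro root_of_unity_eqD) (simp_all add: cohen_residues_def)
  have "r dvd k"
    using cohen_residues_cross_eq_imp_dvd[OF assms(1,2,4) cross_eq] .
  moreover have "k dvd r"
    using cohen_residues_cross_eq_imp_dvd[OF assms(1,3,5) cross_eq[symmetric]] .
  ultimately have "r = k"
    by (rule dvd_antisym)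
  then show "r = k \<and> a = b"
    using cross_eq assms(2) by simp
qed simp

text \<open>As \<open>c\<^sub>k\<close> is real, it may be conjugated; the frequencies \<open>a / r\<^sup>s\<close> of \<open>c\<^sub>r\<close> and
  \<open>b / k\<^sup>s\<close> of \<open>c\<^sub>k\<close> then resonate exactly when they are equal.\<close>

lemma shifted_mean_cohen_ramanujan_sum_tendsto:
  assumes "s > 0" "r > 0" "k > 0"
  shows "shifted_mean (cohen_ramanujan_sum s r) (cohen_ramanujan_sum s k) h
    \<longlonglongrightarrow> (if r = k then cohen_ramanujan_sum s r h else 0)"
proof -
  let ?w = "root_of_unity (r ^ s)" and ?v = "\<lambda>b. cnj (root_of_unity (k ^ s) b)"
  let ?U = "cohen_residues s r" and ?V = "cohen_residues s k"
  have c_r: "cohen_ramanujan_sum s r = (\<lambda>n. \<Sum>a\<in>?U. ?w a ^ n)"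
    by (simp add: fun_eq_iff cohen_ramanujan_sum_eq_powers)
  have c_k: "cohen_ramanujan_sum s k = (\<lambda>n. \<Sum>b\<in>?V. ?v b ^ n)"
  proof
    fix n
    have "cohen_ramanujan_sum s k n = cnj (cohen_ramanujan_sum s k n)"
      using cnj_cohen_ramanujan_sum[OF assms(1,3)] by simp
    then show "cohen_ramanujan_sum s k n = (\<Sum>b\<in>?V. ?v b ^ n)"
      by (simp add: cohen_ramanujan_sum_eq_powers)
  qed
  have "shifted_mean (cohen_ramanujan_sum s r) (cohen_ramanujan_sum s k) h
      \<longlonglongrightarrow> (\<Sum>a\<in>?U. \<Sum>b\<in>?V. ?v b ^ h * of_bool (?w a * ?v b = 1))"
    unfolding c_k unfolding c_r by (rule shifted_mean_power_sums_tendsto) simp_all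
  also have "(\<Sum>a\<in>?U. \<Sum>b\<in>?V. ?v b ^ h * of_bool (?w a * ?v b = 1)) =
      (\<Sum>a\<in>?U. \<Sum>b\<in>?V. if r = k \<and> a = b then ?v b ^ h else 0)"
    using assms
    by (intro sum.cong refl) (simp add: mult_cnj_eq_1_iff root_of_unity_cohen_residues_eq_iff)
  also have "\<dots> = (if r = k then \<Sum>b\<in>?V. ?v b ^ h else 0)"
    by (simp add: cohen_residues_def)
  also have "\<dots> = (if r = k then cohen_ramanujan_sum s r h else 0)"
    by (simp add: c_k)
  finally show ?thesis .
qed

subsection \<open>Unconditional sums\<close>

lemma has_sum_sum:
  fixes F :: "'i \<Rightarrow> 'a \<Rightarrow> 'b :: topological_comm_monoid_add"
  assumes "finite I" "\<And>i. i \<in> I \<Longrightarrow> (F i has_sum S i) X"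
  shows "((\<lambda>x. \<Sum>i\<in>I. F i x) has_sum (\<Sum>i\<in>I. S i)) X"
  using assms by (induction I rule: finite_induct) (auto intro!: has_sum_add)

lemma has_sum_product:
  fixes u :: "'a \<Rightarrow> 'c :: {real_normed_field, banach}" and v :: "'b \<Rightarrow> 'c"
  assumes "u abs_summable_on A" "v abs_summable_on B" "(u has_sum x) A" "(v has_sum y) B"
  shows "((\<lambda>(a, b). u a * v b) has_sum (x * y)) (A \<times> B)"
proof (rule has_sum_SigmaI)
  show "((\<lambda>a. u a * y) has_sum x * y) A"
    by (rule has_sum_cmult_left[OF assms(3)])
  show "((\<lambda>b. case (a, b) of (a, b) \<Rightarrow> u a * v b) has_sum u a * y) B" for a
    using has_sum_cmult_right[OF assms(4), of "u a"] by simp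
  have "(\<lambda>(a, b). u a * v b) abs_summable_on A \<times> B"
    using assms(1,2)
    by (auto simp: Infinite_Sum.abs_summable_on_Sigma_iff norm_mult infsum_cmult_right' abs_mult
         intro!: summable_on_cmult_right summable_on_cmult_left)
  then show "(\<lambda>(a, b). u a * v b) summable_on A \<times> B"
    by (rule abs_summable_summable)
qed

lemma has_sum_diagonal_iff:
  fixes f :: "'a \<Rightarrow> 'b :: {comm_monoid_add, topological_space}"
  shows "((\<lambda>(x, y). if x = y then f x else 0) has_sum S) (A \<times> A) \<longleftrightarrow> (f has_sum S) A"
proof -
  let ?d = "\<lambda>x. (x, x)"
  have "((\<lambda>(x, y). if x = y then f x else 0) has_sum S) (A \<times> A) \<longleftrightarrow>
      ((\<lambda>(x, y). if x = y then f x else 0) has_sum S) (?d ` A)"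
    by (intro has_sum_cong_neutral) auto
  also have "\<dots> \<longleftrightarrow> (((\<lambda>(x, y). if x = y then f x else 0) \<circ> ?d) has_sum S) A"
    by (intro has_sum_reindex inj_onI) simp
  finally show ?thesis
    by (simp add: comp_def)
qed

lemma dominated_convergence_has_sum:
  fixes F :: "'i \<Rightarrow> 'a \<Rightarrow> 'b :: banach"
  assumes "L \<noteq> bot" "M summable_on X"
    and dominated: "\<And>i x. x \<in> X \<Longrightarrow> norm (F i x) \<le> M x"
    and lim: "\<And>x. x \<in> X \<Longrightarrow> ((\<lambda>i. F i x) \<longlongrightarrow> G x) L"
    and sums: "\<And>i. (F i has_sum S i) X"
  obtains l where "(G has_sum l) X" "(S \<longlongrightarrow> l) L"
proof
  have "norm (G x) \<le> M x" if "x \<in> X" for x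
    using tendsto_norm[OF lim[OF that]] dominated[OF that] assms(1)
    by (intro tendsto_upperbound) auto
  then have "G summable_on X"
    by (intro abs_summable_summable[OF Infinite_Sum.abs_summable_on_comparison_test'[OF assms(2)]])
  then show "(G has_sum infsum G X) X"
    by (rule has_sum_infsum)
  then have sum_G: "(sum G \<longlongrightarrow> infsum G X) (finite_subsets_at_top X)"
    by (simp add: has_sum_def)
  show "(S \<longlongrightarrow> infsum G X) L"
  proof (rule swap_uniform_limit'[OF _ sum_G])
    show "uniform_limit UNIV (\<lambda>Y i. \<Sum>x\<in>Y. F i x) S (finite_subsets_at_top X)"
      using dominated sums assms(2) by (intro Weierstrass_m_test_general') auto
    show "\<forall>\<^sub>F Y in finite_subsets_at_top X. ((\<lambda>i. \<Sum>x\<in>Y. F i x) \<longlongrightarrow> sum G Y) L"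
      using lim by (intro eventually_finite_subsets_at_top_weakI tendsto_sum) auto
  qed auto
qed

subsection \<open>The asymptotic formula\<close>

lemma has_sum_shifted_mean:
  assumes "abs_conv_cr_expansion s f fh" "abs_conv_cr_expansion s g gh"
  shows "((\<lambda>(r, k). fh r * gh k *
      shifted_mean (cohen_ramanujan_sum s r) (cohen_ramanujan_sum s k) h N)
    has_sum shifted_mean f g h N) ({1..} \<times> {1..})"
proof -
  let ?c = "cohen_ramanujan_sum s"
  let ?F = "\<lambda>n (r, k). fh r * ?c r n * (gh k * ?c k (n + h))"
  have "(?F n has_sum (f n * g (n + h))) ({1..} \<times> {1..})" if "n \<in> {1..N}" for n
    using assms that by (intro has_sum_product) (auto simp: abs_conv_cr_expansion_def)
  then have "((\<lambda>x. (\<Sum>n=1..N. ?F n x) / of_nat N) has_sum shifted_mean f g h N) ({1..} \<times> {1..})"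
    unfolding shifted_mean_def divide_inverse
    by (intro has_sum_cmult_left has_sum_sum) auto
  also have "(\<lambda>x. (\<Sum>n=1..N. ?F n x) / of_nat N) =
      (\<lambda>(r, k). fh r * gh k * shifted_mean (?c r) (?c k) h N)"
    by (auto simp: shifted_mean_def sum_distrib_left mult_ac)
  finally show ?thesis .
qed

lemma shifted_mean_cr_expansions_tendsto:
  assumes "s > 0"
    and expansions: "abs_conv_cr_expansion s f fh" "abs_conv_cr_expansion s g gh"
    and summable: "(\<lambda>(r, k). norm (fh r) * norm (gh k) * sqrt (real (r ^ s) * real (k ^ s))
            * real (tau_s s (r ^ s)) * real (tau_s s (k ^ s))) summable_on ({1..} \<times> {1..})"
      (is "?B summable_on _")
  obtains C where "((\<lambda>r. fh r * gh r * cohen_ramanujan_sum s r h) has_sum C) {1..}"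
    "shifted_mean f g h \<longlonglongrightarrow> C"
proof -
  let ?c = "cohen_ramanujan_sum s"
  define F where "F N = (\<lambda>(r, k). fh r * gh k * shifted_mean (?c r) (?c k) h N)" for N
  define G where "G = (\<lambda>(r, k). if r = k then fh r * gh r * ?c r h else 0)"
  have "norm (F N (r, k)) \<le> sqrt (real (1 + h)) * ?B (r, k)" if "r > 0" "k > 0" for N r k
    using norm_shifted_mean_cohen_ramanujan_sum_le[OF assms(1) that, where N = N and h = h,
        THEN mult_left_mono, of "norm (fh r * gh k)"]
    by (simp add: F_def norm_mult mult_ac)
  then have dominated: "norm (F N x) \<le> sqrt (real (1 + h)) * ?B x" if "x \<in> {1..} \<times> {1..}" for N x
    using that by (auto simp: Suc_le_eq)
  have termwise: "(\<lambda>N. F N x) \<longlonglongrightarrow> G x" if "x \<in> {1..} \<times> {1..}" for x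
  proof -
    obtain r k where x_eq: "x = (r, k)" and "r > 0" "k > 0"
      using \<open>x \<in> _\<close> by (auto simp: Suc_le_eq)
    then have "(\<lambda>N. F N x) \<longlonglongrightarrow> fh r * gh k * (if r = k then ?c r h else 0)"
      unfolding F_def x_eq prod.case
      by (intro tendsto_mult_left shifted_mean_cohen_ramanujan_sum_tendsto assms(1))
    then show ?thesis
      by (simp add: G_def x_eq split: if_splits)
  qed
  have sums: "(F N has_sum shifted_mean f g h N) ({1..} \<times> {1..})" for N
    unfolding F_def by (rule has_sum_shifted_mean[OF expansions])
  have "(\<lambda>x. sqrt (real (1 + h)) * ?B x) summable_on {1..} \<times> {1..}"
    using summable by (rule summable_on_cmult_right)
  then obtain C where "(G has_sum C) ({1..} \<times> {1..})" "shifted_mean f g h \<longlonglongrightarrow> C"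
    using dominated_convergence_has_sum[OF sequentially_bot _ dominated termwise sums] by blast
  then show thesis
    using that unfolding G_def has_sum_diagonal_iff by blast
qed

lemma diff_smallo_if_quotient_tendsto:
  fixes f g :: "'a \<Rightarrow> 'b :: real_normed_field"
  assumes "((\<lambda>x. f x / g x) \<longlongrightarrow> c) F" "\<forall>\<^sub>F x in F. g x \<noteq> 0"
  shows "(\<lambda>x. f x - g x * c) \<in> o[F](g)"
proof (rule smalloI_tendsto[OF _ assms(2)])
  have "((\<lambda>x. f x / g x - c) \<longlongrightarrow> 0) F"
    using assms(1) by (simp add: LIM_zero_iff)
  moreover have "\<forall>\<^sub>F x in F. f x / g x - c = (f x - g x * c) / g x"
    using assms(2) by eventually_elim (simp add: field_simps)
  ultimately show "((\<lambda>x. (f x - g x * c) / g x) \<longlongrightarrow> 0) F"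
    by (rule Lim_transform_eventually)
qed

theorem theorem1p2:
  fixes s h :: nat and f g fh gh :: "nat \<Rightarrow> complex"
  assumes "s \<ge> 1" and "h \<ge> 1"
    and "abs_conv_cr_expansion s f fh"
    and "abs_conv_cr_expansion s g gh"
    and "(\<lambda>(r, k). norm (fh r) * norm (gh k) * sqrt (real (r ^ s) * real (k ^ s))
            * real (tau_s s (r ^ s)) * real (tau_s s (k ^ s))) summable_on ({1..} \<times> {1..})"
  shows "(\<lambda>r. fh r * gh r * cohen_ramanujan_sum s r h) summable_on {1..} \<and>
    (let C = (\<Sum>\<^sub>\<infinity>r\<in>{1..}. fh r * gh r * cohen_ramanujan_sum s r h);
         S = (\<lambda>N::nat. \<Sum>n=1..N. f n * g (n + h))
     in (C \<noteq> 0 \<longrightarrow> S \<sim>[at_top] (\<lambda>N. of_nat N * C)) \<and>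
        (\<lambda>N. S N - of_nat N * C) \<in> o[at_top](\<lambda>N. of_nat N))"
proof -
  define S where "S = (\<lambda>N::nat. \<Sum>n=1..N. f n * g (n + h))"
  have "s > 0"
    using assms(1) by simp
  then obtain C where has_sum: "((\<lambda>r. fh r * gh r * cohen_ramanujan_sum s r h) has_sum C) {1..}"
    and mean: "shifted_mean f g h \<longlonglongrightarrow> C"
    using shifted_mean_cr_expansions_tendsto assms(3-5) by blast
  have "(\<lambda>N. S N - of_nat N * C) \<in> o(\<lambda>N. of_nat N)"
  proof (rule diff_smallo_if_quotient_tendsto)
    show "(\<lambda>N. S N / of_nat N) \<longlonglongrightarrow> C"
      using mean by (simp add: shifted_mean_def S_def)
    show "\<forall>\<^sub>F N in sequentially. (of_nat N :: complex) \<noteq> 0"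
      using eventually_gt_at_top[of 0] by eventually_elim simp
  qed
  moreover from this have "S \<sim>[at_top] (\<lambda>N. of_nat N * C)" if "C \<noteq> 0"
    using that by (simp add: asymp_equiv_altdef)
  ultimately show ?thesis
    using has_sum by (simp add: Let_def S_def has_sum_iff)
qed

end
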